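(* For every integer $n\ge 1$, the number $a_t^C(S_{n+1})$ of time-dependent assembly trees satisfying the connected gluing rule for the star graph $S_{n+1}$ on $n+1$ vertices is $$a_t^C(S_{n+1})=\sum_{k=1}^{n}k!\,S_2(n,k),$$ where $S_2(n,k)$ denotes the Stirling number of the second kind.
   Context: All graphs are finite and simple. Let $G=(V,E)$ be a connected graph with $|V|=N\ge 2$. A time-dependent assembly tree for $G$ is a rooted (unordered) tree each of whose nodes is labeled by a pair $(U,i)$ with $U\subseteq V$ and $i$ a nonnegative integer, such that: (1) the leaves are exactly $N$ in number, labeled $(v,0)$, one for each vertex $v\in V$ ($v$ identified with $\{v\}$); (2) each internal (non-leaf) node has at least two children; (3) the root is labeled $(V,m)$ for some $1\le m\le N-1$; (4) for each internal node $(U,i)$, $U$ is the union of the vertex sets labeling its children (equivalently, the set of leaves below it); (5) if $(U,i)$ and $(U',i')$ are adjacent nodes with $U\subseteq U'$, then $i<i'$; (6) for each $0\le i\le m$ there exists a node labeled $(U,i)$ for some $U\subseteq V$. Two such trees are the same if there is a label-preserving isomorphism of rooted trees between them. Such a tree satisfies the connected gluing rule if for each internal node $(U,i)$ the subgraph of $G$ induced by $U$ is connected. $a_t^C(G)$ is the number of time-dependent assembly trees for $G$ satisfying the connected gluing rule. The star graph $S_{n+1}$ has one center vertex and $n$ other vertices, each adjacent to the center only. *)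

theory Defs
  imports
    "Graph_Theory.Digraph_Component"
    "HOL-Library.Multiset"
    "HOL-Combinatorics.Stirling"
begin

(* Finite simple graphs are the symmetric loop-free pair digraphs of locale pair_graph. *)

definition star_graph :: "'a \<Rightarrow> 'a set \<Rightarrow> 'a pair_pre_digraph" where
  "star_graph c L = \<lparr> pverts = insert c L, parcs = {c} \<times> L \<union> L \<times> {c} \<rparr>"

lemma pair_graph_star_graph:
  assumes "finite L" "c \<notin> L"
  shows "pair_graph (star_graph c L)"
  using assms
  by unfold_locales (auto simp: star_graph_def symmetric_def intro!: symI)

(* Children form a multiset, so two values of this type are equal iff there is a
   label-preserving isomorphism of rooted unordered trees between them: counting
   values is counting trees up to isomorphism. *)
datatype 'a ltree = Node (block: "'a set") (time: nat) (children: "'a ltree multiset")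

(* A node is identified with the subtree hanging below it.  Distinct nodes with isomorphic
   subtrees coincide here; this is harmless for properties that hold of all (or some) nodes,
   but leaves, which have to be counted, are collected in a multiset. *)
primrec nodes :: "'a ltree \<Rightarrow> 'a ltree set" where
  "nodes (Node U i ts) = insert (Node U i ts) (\<Union> (set_mset (image_mset nodes ts)))"

primrec leaf_labels :: "'a ltree \<Rightarrow> ('a set \<times> nat) multiset" where
  "leaf_labels (Node U i ts) =
     (if ts = {#} then {#(U, i)#} else \<Sum>\<^sub># (image_mset leaf_labels ts))"

definition internal_nodes :: "'a ltree \<Rightarrow> 'a ltree set" where
  "internal_nodes T = {t \<in> nodes T. children t \<noteq> {#}}"

definition adjacent_nodes :: "'a ltree \<Rightarrow> 'a ltree \<Rightarrow> 'a ltree \<Rightarrow> bool" where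
  "adjacent_nodes T s t \<longleftrightarrow>
     s \<in> nodes T \<and> t \<in> nodes T \<and> (s \<in># children t \<or> t \<in># children s)"

(* Intended for connected G satisfying pair_graph with at least two vertices. *)
definition time_dependent_assembly_tree :: "'a pair_pre_digraph \<Rightarrow> 'a ltree \<Rightarrow> bool" where
  "time_dependent_assembly_tree G T \<longleftrightarrow>
     (\<forall>t \<in> nodes T. block t \<subseteq> pverts G) \<and>
     leaf_labels T = image_mset (\<lambda>v. ({v}, 0)) (mset_set (pverts G)) \<and>
     (\<forall>t \<in> internal_nodes T. size (children t) \<ge> 2) \<and>
     block T = pverts G \<and> 1 \<le> time T \<and> time T \<le> card (pverts G) - 1 \<and>
     (\<forall>t \<in> internal_nodes T. block t = \<Union> (block ` set_mset (children t))) \<and>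
     (\<forall>s t. adjacent_nodes T s t \<and> block s \<subseteq> block t \<longrightarrow> time s < time t) \<and>
     (\<forall>i \<le> time T. \<exists>t \<in> nodes T. time t = i)"

definition connected_gluing_rule :: "'a pair_pre_digraph \<Rightarrow> 'a ltree \<Rightarrow> bool" where
  "connected_gluing_rule G T \<longleftrightarrow>
     (\<forall>t \<in> internal_nodes T. Digraph_Component.connected (with_proj G \<restriction> block t))"

definition num_connected_time_assembly_trees :: "'a pair_pre_digraph \<Rightarrow> nat" where
  "num_connected_time_assembly_trees G =
     card {T. time_dependent_assembly_tree G T \<and> connected_gluing_rule G T}"

end

theory Submission
  imports Defs "HOL-Library.FuncSet" "HOL-Library.Disjoint_Sets"
begin

text \<open>
  A set of at least two vertices of the star with centre \<^term>\<open>c\<close> induces a connected subgraph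
  exactly when it contains \<^term>\<open>c\<close>.  In an assembly tree obeying the connected gluing rule, every
  internal node therefore contains \<^term>\<open>c\<close>.  Siblings have disjoint blocks, so at most one child
  of a node is internal: the tree is a caterpillar, whose spine of internal nodes runs from the
  root down to the leaf \<^term>\<open>c\<close>, with further leaves hanging off every spine node.  Times strictly
  decrease down the spine, every other node has time 0, and every time up to the root's must occur,
  so the spine nodes have exactly the times \<open>1, \<dots>, k\<close>.

  Such a tree is determined by the time at which each non-central vertex is glued in, and every
  spine node glues in at least one new vertex.  Trees whose root has time \<open>k\<close> thus correspond to
  surjections from \<open>L\<close> onto \<open>{1..k}\<close>, of which there are \<open>k!\<close> times the Stirling number
  (\<open>card_surjections\<close>).  The caterpillar of a surjection is \<open>caterpillar\<close>; the structural half of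
  the correspondence is \<open>hub_tree_is_caterpillar\<close>, injectivity is \<open>caterpillar_inject\<close>, and
  \<open>caterpillar_is_assembly_tree\<close> is the converse.
\<close>

section \<open>Counting surjections\<close>

definition surjections :: "'a set \<Rightarrow> 'b set \<Rightarrow> ('a \<Rightarrow> 'b) set" where
  "surjections A B = {f \<in> A \<rightarrow>\<^sub>E B. f ` A = B}"

lemma finite_surjections: "finite A \<Longrightarrow> finite B \<Longrightarrow> finite (surjections A B)"
  unfolding surjections_def by (simp add: finite_PiE)

text \<open>
  Removing the argument \<open>x\<close> from a surjection leaves a function that is still onto, or one that
  misses exactly the value \<open>y\<close> taken at \<open>x\<close>.
\<close>

lemma surjections_insert:
  assumes "x \<notin> A"
  shows "surjections (insert x A) B =
    (\<lambda>(y, g). g(x := y)) ` (SIGMA y:B. surjections A B \<union> surjections A (B - {y}))"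
    (is "?S = ?h ` ?P")
proof
  show "?h ` ?P \<subseteq> ?S"
  proof
    fix f assume "f \<in> ?h ` ?P"
    then obtain y g where f: "y \<in> B" "g \<in> A \<rightarrow>\<^sub>E B" "g ` A = B \<or> g ` A = B - {y}" "f = g(x := y)"
      by (auto simp: surjections_def PiE_iff)
    then have "f \<in> insert x A \<rightarrow>\<^sub>E B" by (auto simp: PiE_insert_eq)
    moreover have "f ` insert x A = insert y (g ` A)" using f(4) assms by auto
    ultimately show "f \<in> ?S" using f(1,3) by (auto simp: surjections_def)
  qed
  show "?S \<subseteq> ?h ` ?P"
  proof
    fix f assume "f \<in> ?S"
    then have f: "f \<in> insert x A \<rightarrow>\<^sub>E B" "f ` insert x A = B"
      by (auto simp: surjections_def)
    then obtain y g where yg: "y \<in> B" "g \<in> A \<rightarrow>\<^sub>E B" "f = g(x := y)"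
      by (auto simp: PiE_insert_eq)
    have "insert y (g ` A) = B"
      using f(2) yg(3) assms by auto
    then consider "g ` A = B" | "g ` A = B - {y}"
      using yg(1) by blast
    then have "g \<in> surjections A B \<union> surjections A (B - {y})"
      using yg(2) by cases (auto simp: surjections_def PiE_iff)
    then show "f \<in> ?h ` ?P"
      using yg by (intro image_eqI[of _ _ "(y, g)"]) auto
  qed
qed

text \<open>
  With \<open>b\<close> the size of the codomain, the decomposition above gives the recursion
  \<open>s(a + 1, b) = b (s(a, b) + s(a, b - 1))\<close>, which is the recursion of the Stirling numbers of the
  second kind multiplied by \<open>b!\<close>.
\<close>

lemma card_surjections:
  assumes "finite A" "finite B"
  shows "card (surjections A B) = fact (card B) * Stirling (card A) (card B)"
  using assms
proof (induction A arbitrary: B rule: finite_induct)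
  case empty
  show ?case
  proof (cases "B = {}")
    case True
    then show ?thesis by (simp add: surjections_def)
  next
    case False
    then obtain k where "card B = Suc k"
      using empty by (metis card_eq_0_iff not0_implies_Suc)
    then show ?thesis using False by (auto simp: surjections_def)
  qed
next
  case (insert x A)
  let ?P = "SIGMA y:B. surjections A B \<union> surjections A (B - {y})"
  have "inj_on (\<lambda>(y, g). g(x := y)) ?P"
    using insert.hyps
    by (intro inj_on_subset[OF inj_combinator[of x A "\<lambda>_. B"]]) (auto simp: surjections_def)
  then have "card (surjections (insert x A) B) = card ?P"
    using insert.hyps by (simp add: surjections_insert card_image)
  also have "\<dots> = (\<Sum>y\<in>B. card (surjections A B \<union> surjections A (B - {y})))"
    using insert by (intro card_SigmaI) (auto simp: finite_surjections)
  also have "\<dots> = (\<Sum>y\<in>B. card (surjections A B) + card (surjections A (B - {y})))"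
    using insert by (intro sum.cong refl card_Un_disjoint finite_surjections)
      (auto simp: surjections_def)
  also have "\<dots> = (\<Sum>y\<in>B. fact (card B) * Stirling (card A) (card B)
      + fact (card B - 1) * Stirling (card A) (card B - 1))"
    using insert by (intro sum.cong) auto
  also have "\<dots> = fact (card B) * Stirling (card (insert x A)) (card B)"
    using insert by (cases "card B") (auto simp: algebra_simps)
  finally show ?case .
qed

section \<open>Connected vertex sets of a star\<close>

text \<open>
  Every edge of the star has \<open>c\<close> as an end, so without \<open>c\<close> the induced subgraph has no edges, and
  with \<open>c\<close> every vertex is joined to it.  A single non-central vertex is connected without
  containing \<open>c\<close>, which is why singletons are excluded.
\<close>

lemma connected_star_iff:
  assumes "c \<notin> L" "U \<subseteq> insert c L" "\<not> is_singleton U"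
  shows "Digraph_Component.connected (with_proj (star_graph c L) \<restriction> U) \<longleftrightarrow> c \<in> U"
proof -
  define E where "E = {c} \<times> (U \<inter> L) \<union> (U \<inter> L) \<times> {c}"
  let ?G = "with_proj (star_graph c L) \<restriction> U"
  have arcs_G: "arcs ?G = (if c \<in> U then E else {})"
    using assms(1,2) by (cases "c \<in> U") (auto simp: E_def star_graph_def)
  have arcs: "parcs (mk_symmetric ?G) = (if c \<in> U then E else {})"
    unfolding parcs_mk_symmetric arcs_G induce_subgraph_tail induce_subgraph_head with_proj_simps
    by (auto simp: E_def)
  have conn: "Digraph_Component.connected ?G \<longleftrightarrow>
      U \<noteq> {} \<and> (\<forall>u\<in>U. \<forall>v\<in>U. (u, v) \<in> rtrancl_on U (if c \<in> U then E else {}))"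
    by (simp add: Digraph_Component.connected_def strongly_connected_def reachable_def arcs)
  show ?thesis
  proof
    assume c: "c \<in> U"
    have to: "(u, c) \<in> rtrancl_on U E" and from_c: "(c, u) \<in> rtrancl_on U E" if "u \<in> U" for u
      using that c assms(2) by (auto simp: E_def intro: rtrancl_on_into_rtrancl_on)
    show "Digraph_Component.connected ?G"
      unfolding conn using c by (auto intro: rtrancl_on_trans[OF to from_c])
  next
    assume con: "Digraph_Component.connected ?G"
    show "c \<in> U"
    proof (rule ccontr)
      assume c: "c \<notin> U"
      have "u = v" if "(u, v) \<in> rtrancl_on U {}" for u v
        using that by induction auto
      then have "\<forall>u\<in>U. \<forall>v\<in>U. u = v" "U \<noteq> {}" using con c unfolding conn by auto
      then have "is_singleton U" by (metis is_singletonI')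
      then show False using assms(3) by simp
    qed
  qed
qed

section \<open>Caterpillars\<close>

abbreviation leaf :: "'a \<Rightarrow> 'a ltree" where
  "leaf v \<equiv> Node {v} 0 {#}"

abbreviation leaf_label :: "'a \<Rightarrow> 'a set \<times> nat" where
  "leaf_label v \<equiv> ({v}, 0)"

text \<open>
  The assembly process that starts from the centre \<open>c\<close> and glues in all vertices of the level set
  \<open>B i\<close> at time \<open>i\<close>.
\<close>

primrec caterpillar :: "'a \<Rightarrow> (nat \<Rightarrow> 'a set) \<Rightarrow> nat \<Rightarrow> 'a ltree" where
  "caterpillar c B 0 = leaf c"
| "caterpillar c B (Suc k) = Node (insert c (\<Union>i\<in>{1..Suc k}. B i)) (Suc k)
     (add_mset (caterpillar c B k) (image_mset leaf (mset_set (B (Suc k)))))"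

lemma block_caterpillar: "block (caterpillar c B k) = insert c (\<Union>i\<in>{1..k}. B i)"
  by (cases k) auto

lemma time_caterpillar [simp]: "time (caterpillar c B k) = k"
  by (cases k) auto

lemma caterpillar_cong:
  "(\<And>i. i \<in> {1..k} \<Longrightarrow> B i = B' i) \<Longrightarrow> caterpillar c B k = caterpillar c B' k"
  by (induction k) auto

lemma disjoint_family_on_Suc:
  "disjoint_family_on B {1..Suc k} \<longleftrightarrow>
    B (Suc k) \<inter> (\<Union>i\<in>{1..k}. B i) = {} \<and> disjoint_family_on B {1..k}"
  by (simp add: atLeastAtMostSuc_conv disjoint_family_on_insert)

lemma UN_atLeastAtMost_Suc: "(\<Union>i\<in>{1..Suc k}. B i) = B (Suc k) \<union> (\<Union>i\<in>{1..k}. B i)"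
  by (simp add: atLeastAtMostSuc_conv)

text \<open>
  The hub \<open>c\<close> marks the spine: the only child whose block contains \<open>c\<close> is the next spine node.
  So the spine can be read off the tree, and each level set is the difference of the blocks of
  two consecutive spine nodes.
\<close>

lemma caterpillar_inject:
  assumes "caterpillar c B k = caterpillar c B' k"
    and "disjoint_family_on B {1..k}" "disjoint_family_on B' {1..k}"
    and "\<And>i. i \<in> {1..k} \<Longrightarrow> c \<notin> B i \<and> c \<notin> B' i"
    and "\<And>i. i \<in> {1..k} \<Longrightarrow> finite (B i) \<and> finite (B' i)"
    and "i \<in> {1..k}"
  shows "B i = B' i"
  using assms
proof (induction k)
  case 0
  then show ?case by simp
next
  case (Suc k)
  (* The leaves at level Suc k have blocks without c, so this filter keeps the spine child only. *)
  let ?hub = "filter_mset (\<lambda>t. c \<in> block t)"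
  have hub: "?hub (children (caterpillar c D (Suc k))) = {#caterpillar c D k#}"
    if "c \<notin> D (Suc k)" "finite (D (Suc k))" for D
  proof -
    have "set_mset (?hub (image_mset leaf (mset_set (D (Suc k))))) = {}"
      using that by auto
    then have "?hub (image_mset leaf (mset_set (D (Suc k)))) = {#}"
      by (simp only: set_mset_eq_empty_iff)
    then show ?thesis by (simp add: block_caterpillar)
  qed
  have eq: "caterpillar c B k = caterpillar c B' k"
  proof -
    have "?hub (children (caterpillar c B (Suc k))) = {#caterpillar c B k#}"
      "?hub (children (caterpillar c B' (Suc k))) = {#caterpillar c B' k#}"
      using Suc.prems(4,5)[of "Suc k"] by (intro hub; simp)+
    then have "{#caterpillar c B k#} = {#caterpillar c B' k#}"
      unfolding Suc.prems(1) by (rule subst)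
    then show ?thesis by simp
  qed
  show ?case
  proof (cases "i = Suc k")
    case False
    then show ?thesis
      using Suc.IH[OF eq] Suc.prems(2-6) by (simp add: disjoint_family_on_Suc del: One_nat_def)
  next
    case True
    have top: "D (Suc k) = block (caterpillar c D (Suc k)) - block (caterpillar c D k)"
      if "disjoint_family_on D {1..Suc k}" "c \<notin> D (Suc k)" for D
      using that unfolding block_caterpillar UN_atLeastAtMost_Suc disjoint_family_on_Suc by blast
    show ?thesis
      using top[OF Suc.prems(2)] top[OF Suc.prems(3)] Suc.prems(4)[of "Suc k"]
      unfolding True eq Suc.prems(1) by simp
  qed
qed

section \<open>Trees whose internal nodes share a vertex\<close>

text \<open>
  What the assembly conditions say locally about a tree whose internal blocks all contain \<open>c\<close>.
  Unlike the conditions on leaves and on the set of times, this passes to subtrees and so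
  supports induction.
\<close>

definition hub_tree :: "'a \<Rightarrow> 'a ltree \<Rightarrow> bool" where
  "hub_tree c T \<longleftrightarrow> (\<forall>t\<in>internal_nodes T. 2 \<le> size (children t) \<and>
     block t = \<Union> (block ` set_mset (children t)) \<and> c \<in> block t \<and>
     (\<forall>s\<in>#children t. time s < time t))"

lemma root_in_nodes [simp]: "T \<in> nodes T"
  by (cases T) auto

lemma internal_nodes_Node:
  "internal_nodes (Node U i ts) =
     (if ts = {#} then {} else insert (Node U i ts) (\<Union>s\<in>set_mset ts. internal_nodes s))"
  by (auto simp: internal_nodes_def)

lemma hub_tree_Node:
  "hub_tree c (Node U i ts) \<longleftrightarrow>
     (ts \<noteq> {#} \<longrightarrow> 2 \<le> size ts \<and> U = \<Union> (block ` set_mset ts) \<and> c \<in> U \<and>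
       (\<forall>s\<in>#ts. time s < i)) \<and> (\<forall>s\<in>#ts. hub_tree c s)"
  by (auto simp: hub_tree_def internal_nodes_Node)

lemma time_le_root: "hub_tree c T \<Longrightarrow> t \<in> nodes T \<Longrightarrow> time t \<le> time T"
proof (induction T)
  case (Node U i ts)
  then show ?case by (fastforce simp: hub_tree_Node)
qed

lemma nodes_mono: "t \<in> nodes T \<Longrightarrow> nodes t \<subseteq> nodes T"
proof (induction T)
  case (Node U i ts)
  then show ?case by auto
qed

lemma leaf_labels_mono: "t \<in> nodes T \<Longrightarrow> leaf_labels t \<subseteq># leaf_labels T"
proof (induction T)
  case (Node U i ts)
  show ?case
  proof (cases "t = Node U i ts")
    case False
    then obtain s where s: "s \<in># ts" "t \<in> nodes s" using Node.prems by auto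
    have "leaf_labels t \<subseteq># leaf_labels s" using Node.IH s by blast
    also have "leaf_labels s \<subseteq># leaf_labels (Node U i ts)"
      using s(1) by (auto dest!: multi_member_split)
    finally show ?thesis .
  qed simp
qed

lemma time_leaf_label: "(W, j) \<in># leaf_labels T \<Longrightarrow> j \<in> time ` nodes T"
proof (induction T)
  case (Node U i ts)
  show ?case
  proof (cases "ts = {#}")
    case True
    then show ?thesis using Node.prems by simp
  next
    case False
    then obtain s where "s \<in># ts" "(W, j) \<in># leaf_labels s" using Node.prems by auto
    then show ?thesis using Node.IH by fastforce
  qed
qed

lemma leaf_labels_nonempty: "leaf_labels T \<noteq> {#}"
proof (induction T)
  case (Node U i ts)
  then show ?case by (cases ts) auto
qed

lemma block_mono:
  assumes "\<forall>t\<in>internal_nodes T. block t = \<Union> (block ` set_mset (children t))" "t \<in> nodes T"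
  shows "block t \<subseteq> block T"
  using assms
proof (induction T)
  case (Node U i ts)
  show ?case
  proof (cases "t = Node U i ts")
    case False
    then obtain s where s: "s \<in># ts" "t \<in> nodes s" using Node.prems by auto
    have "\<forall>t\<in>internal_nodes s. block t = \<Union> (block ` set_mset (children t))"
      using Node.prems(1) s(1) by (auto simp: internal_nodes_Node split: if_splits)
    then have "block t \<subseteq> block s" using Node.IH s by simp
    also have "block s \<subseteq> U"
      using Node.prems(1) s(1) by (cases "ts = {#}") (auto simp: internal_nodes_Node)
    finally show ?thesis by simp
  qed simp
qed

text \<open>
  Being a submultiset of the labels of finitely many distinct vertices passes from a tree to its
  subtrees; it replaces the exact description of the leaves in inductive arguments.
\<close>

lemma count_leaf_label_le_1: "count (image_mset leaf_label (mset_set V)) x \<le> 1"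
  by (simp add: image_mset_mset_set inj_on_def count_mset_set')

text \<open>
  Applied to the leaf labels of two siblings, this makes their blocks disjoint.
\<close>

lemma no_common_leaf_label:
  assumes "M + N \<subseteq># image_mset leaf_label (mset_set V)" "x \<in># M" "x \<in># N"
  shows False
proof -
  have "0 < count M x" "0 < count N x" using assms(2,3) by simp_all
  moreover have "count M x + count N x \<le> 1"
    using mset_subset_eq_count[OF assms(1), of x] count_leaf_label_le_1[of V x] by simp
  ultimately show False by linarith
qed

lemma mem_block_iff_leaf_label:
  assumes "\<forall>t\<in>internal_nodes T. block t = \<Union> (block ` set_mset (children t))"
    and "set_mset (leaf_labels T) \<subseteq> range leaf_label"
  shows "v \<in> block T \<longleftrightarrow> leaf_label v \<in># leaf_labels T"
  using assms
proof (induction T)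
  case (Node U i ts)
  show ?case
  proof (cases "ts = {#}")
    case True
    then show ?thesis using Node.prems by auto
  next
    case False
    have "v \<in> block s \<longleftrightarrow> leaf_label v \<in># leaf_labels s" if "s \<in># ts" for s
      using Node.IH[OF that] Node.prems that False by (auto simp: internal_nodes_Node)
    then show ?thesis using Node.prems False by (auto simp: internal_nodes_Node)
  qed
qed

text \<open>
  Two children contribute at least one leaf each; if the block were \<open>{v}\<close>, both would contribute
  the leaf \<open>v\<close>, which occurs only once.
\<close>

lemma root_block_not_singleton:
  assumes "\<forall>t\<in>internal_nodes T. block t = \<Union> (block ` set_mset (children t))"
    and "leaf_labels T \<subseteq># image_mset leaf_label (mset_set V)" "2 \<le> size (children T)"
  shows "\<not> is_singleton (block T)"
proof
  assume "is_singleton (block T)"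
  then obtain v where v: "block T = {v}" by (auto simp: is_singleton_def)
  obtain U i ts where T: "T = Node U i ts" by (cases T)
  obtain s ts1 where ts1: "ts = add_mset s ts1" using assms(3) T by (cases ts) auto
  then obtain s' ts' where ts: "ts = add_mset s (add_mset s' ts')"
    using assms(3) T by (cases ts1) auto
  have range: "set_mset (leaf_labels T) \<subseteq> range leaf_label"
    using set_mset_mono[OF assms(2)] by (cases "finite V") auto
  have "set_mset (leaf_labels T) \<subseteq> {leaf_label v}"
  proof
    fix x assume x: "x \<in># leaf_labels T"
    then obtain w where "x = leaf_label w" using range by auto
    then show "x \<in> {leaf_label v}"
      using mem_block_iff_leaf_label[OF assms(1) range, of w] x v by simp
  qed
  moreover have labels: "leaf_labels T = leaf_labels s + (leaf_labels s' + (\<Sum>s\<in>#ts'. leaf_labels s))"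
    by (simp add: T ts)
  ultimately have "leaf_label v \<in># leaf_labels s" "leaf_label v \<in># leaf_labels s'"
    using leaf_labels_nonempty[of s] leaf_labels_nonempty[of s'] by (auto elim!: multiset_nonemptyE)
  then show False
    using no_common_leaf_label[OF assms(2)[unfolded labels]] by auto
qed

lemma internal_block_not_singleton:
  assumes "\<forall>t\<in>internal_nodes T. block t = \<Union> (block ` set_mset (children t))"
    and "leaf_labels T \<subseteq># image_mset leaf_label (mset_set V)"
    and "t \<in> nodes T" "2 \<le> size (children t)"
  shows "\<not> is_singleton (block t)"
proof (rule root_block_not_singleton)
  show "\<forall>s\<in>internal_nodes t. block s = \<Union> (block ` set_mset (children s))"
    using assms(1) nodes_mono[OF assms(3)] by (auto simp: internal_nodes_def)
  show "leaf_labels t \<subseteq># image_mset leaf_label (mset_set V)"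
    using leaf_labels_mono[OF assms(3)] assms(2) by (rule subset_mset.order_trans)
qed (fact assms(4))

lemma hub_tree_block:
  "hub_tree c T \<Longrightarrow> \<forall>t\<in>internal_nodes T. block t = \<Union> (block ` set_mset (children t))"
  by (simp add: hub_tree_def)

lemma leaf_if_hub_notin_block:
  assumes "hub_tree c T" "set_mset (leaf_labels T) \<subseteq> range leaf_label" "c \<notin> block T"
  shows "\<exists>v. T = leaf v"
  using assms by (cases T) (auto simp: hub_tree_Node split: if_splits)

text \<open>
  At an internal node exactly one child \<open>t0\<close> contains \<open>c\<close>, because siblings share no leaf; the
  others cannot be internal and are leaves of distinct vertices \<open>B\<close>, and \<open>B\<close> is nonempty because
  there are at least two children.  Since all times below the time \<open>i\<close> of the node occur, and those
  other than 0 occur inside \<open>t0\<close>, the time of \<open>t0\<close> is \<open>i - 1\<close>.  The surjection for \<open>t0\<close> given by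
  induction is then extended by the value \<open>i\<close> on \<open>B\<close>.
\<close>

lemma hub_tree_is_caterpillar:
  assumes "hub_tree c T" "leaf_labels T \<subseteq># image_mset leaf_label (mset_set V)" "finite V"
    and "c \<in> block T" "{0..time T} \<subseteq> time ` nodes T"
  shows "\<exists>f \<in> surjections (block T - {c}) {1..time T}.
    T = caterpillar c (\<lambda>i. {v \<in> block T - {c}. f v = i}) (time T)"
  using assms
proof (induction T)
  case (Node U i ts)
  show ?case
  proof (cases "ts = {#}")
    case True
    then have "U = {c}" "i = 0"
      using Node.prems by (auto dest!: mset_subset_eqD)
    then show ?thesis using True by (auto simp: surjections_def)
  next
    case False
    have labels: "leaf_labels (Node U i ts) = (\<Sum>s\<in>#ts. leaf_labels s)"
      using False by simp
    have U: "2 \<le> size ts" "U = \<Union> (block ` set_mset ts)" "c \<in> U" "\<forall>s\<in>#ts. time s < i"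
      and hub: "\<forall>s\<in>#ts. hub_tree c s"
      using Node.prems(1) False by (auto simp: hub_tree_Node)
    obtain t0 where t0: "t0 \<in># ts" "c \<in> block t0" using U(2,3) by auto
    define rest where "rest = ts - {#t0#}"
    have ts: "ts = add_mset t0 rest" using t0 by (simp add: rest_def)
    have sub: "leaf_labels t0 + (\<Sum>s\<in>#rest. leaf_labels s) \<subseteq># image_mset leaf_label (mset_set V)"
      using Node.prems(2) unfolding labels ts by simp
    have range: "set_mset (leaf_labels s) \<subseteq> range leaf_label" if "s \<in># ts" for s
      using set_mset_mono[OF Node.prems(2)[unfolded labels]] that \<open>finite V\<close> by auto
    have mem_block: "v \<in> block s \<longleftrightarrow> leaf_label v \<in># leaf_labels s" if "s \<in># ts" for s v
      using mem_block_iff_leaf_label hub_tree_block hub range that by metis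
    have not_c: "c \<notin> block s" if "s \<in># rest" for s
    proof
      assume "c \<in> block s"
      with that t0 have "leaf_label c \<in># leaf_labels t0" "leaf_label c \<in># (\<Sum>s\<in>#rest. leaf_labels s)"
        by (auto simp: ts mem_block)
      then show False using no_common_leaf_label[OF sub] by blast
    qed
    have "\<exists>v. s = leaf v" if "s \<in># rest" for s
      using leaf_if_hub_notin_block[of c s] hub range not_c that by (simp add: ts)
    then obtain g where g: "\<And>s. s \<in># rest \<Longrightarrow> s = leaf (g s)" by metis
    (* The vertices at the remaining children, as a multiset until they are shown to be distinct. *)
    define M where "M = image_mset g rest"
    have rest: "rest = image_mset leaf M"
      unfolding M_def using g by (simp add: multiset.map_comp comp_def cong: multiset.map_cong)
    have "(\<Sum>s\<in>#rest. leaf_labels s) = image_mset leaf_label M"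
      unfolding rest by (simp add: multiset.map_comp comp_def)
    with sub have sub': "leaf_labels t0 + image_mset leaf_label M \<subseteq># image_mset leaf_label (mset_set V)"
      by simp
    have M_le_1: "count M v \<le> 1" for v
    proof -
      have "count M v = count (image_mset leaf_label M) (leaf_label v)"
        by (induction M) auto
      also have "\<dots> \<le> 1"
        using mset_subset_eq_count[OF sub', of "leaf_label v"] count_leaf_label_le_1[of V "leaf_label v"]
        by simp
      finally show ?thesis .
    qed
    have M: "M = mset_set (set_mset M)"
    proof (rule multiset_eqI)
      fix v
      show "count M v = count (mset_set (set_mset M)) v"
        using M_le_1[of v] by (cases "count M v") (auto simp: count_mset_set' simp flip: count_greater_zero_iff)
    qed
    define B where "B = set_mset M"
    have B: "rest = image_mset leaf (mset_set B)" "finite B" using rest M by (auto simp: B_def)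
    have "B \<noteq> {}" using U(1) ts B by auto
    have "c \<notin> B" using not_c[of "leaf c"] B by auto
    have "U = block t0 \<union> B" using U(2) B by (auto simp: ts)
    have disj: "block t0 \<inter> B = {}"
      using no_common_leaf_label[OF sub'] t0 by (force simp: mem_block B_def)
    (* The next steps leave no gap between the times of the node and of its spine child. *)
    have times: "time ` nodes (Node U i ts) \<subseteq> {i, 0} \<union> time ` nodes t0"
      using B by (auto simp: ts)
    have t0_le: "time ` nodes t0 \<subseteq> {0..time t0}"
      using time_le_root[of c t0] hub t0 by auto
    have "time t0 < i" using U(4) t0 by auto
    have cover_i: "{0..i} \<subseteq> {i, 0} \<union> time ` nodes t0"
      using subset_trans[OF Node.prems(5) times] unfolding ltree.sel .
    then have "i - 1 \<in> {i, 0} \<union> time ` nodes t0" by (rule subsetD) simp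
    then have "i - 1 \<le> time t0" using t0_le \<open>time t0 < i\<close> by auto
    then have i: "i = Suc (time t0)" using \<open>time t0 < i\<close> by simp
    have "0 \<in> time ` nodes t0"
    proof -
      have "({c}, 0) \<in># leaf_labels t0" using t0 by (simp add: mem_block)
      then show ?thesis by (rule time_leaf_label)
    qed
    moreover have "{0..time t0} \<subseteq> {i, 0} \<union> time ` nodes t0"
      using \<open>time t0 < i\<close> by (intro subset_trans[OF _ cover_i]) simp
    ultimately have cover: "{0..time t0} \<subseteq> time ` nodes t0" using i by auto
    have "leaf_labels t0 \<subseteq># image_mset leaf_label (mset_set V)"
      using mset_subset_eq_add_left sub by (rule subset_mset.order_trans)
    then have "\<exists>f \<in> surjections (block t0 - {c}) {1..time t0}.
        t0 = caterpillar c (\<lambda>i. {v \<in> block t0 - {c}. f v = i}) (time t0)"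
      using Node.IH[of t0] t0 hub \<open>finite V\<close> cover by blast
    then obtain f where f: "f \<in> surjections (block t0 - {c}) {1..time t0}"
      "t0 = caterpillar c (\<lambda>i. {v \<in> block t0 - {c}. f v = i}) (time t0)"
      by blast
    (* B is disjoint from the domain of f, so the override changes no value on a lower level. *)
    define f' where "f' = (\<lambda>v. if v \<in> B then i else f v)"
    have U': "U - {c} = (block t0 - {c}) \<union> B"
      using \<open>U = block t0 \<union> B\<close> \<open>c \<notin> B\<close> by auto
    have image_f': "f' ` (U - {c}) = {1..i}"
    proof -
      have "f' ` (block t0 - {c}) = f ` (block t0 - {c})"
        using disj by (auto simp: f'_def)
      then have "f' ` (block t0 - {c}) = {1..time t0}"
        using f(1) by (simp add: surjections_def)
      moreover have "f' ` B = {i}" using \<open>B \<noteq> {}\<close> by (auto simp: f'_def)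
      ultimately show ?thesis using i by (auto simp: U' image_Un)
    qed
    have "f' \<in> extensional (U - {c})"
      unfolding extensional_def
    proof (intro CollectI allI impI)
      fix v assume "v \<notin> U - {c}"
      then have v: "v \<notin> block t0 - {c}" "v \<notin> B" unfolding U' by blast+
      have "f \<in> extensional (block t0 - {c})"
        using f(1) by (simp add: surjections_def PiE_def)
      then have "f v = undefined" using v(1) by (rule extensional_arb)
      then show "f' v = undefined" using v(2) by (simp only: f'_def if_False)
    qed
    moreover have "f' \<in> (U - {c}) \<rightarrow> {1..i}"
      using equalityD1[OF image_f'] unfolding image_subset_iff_funcset .
    ultimately have "f' \<in> surjections (U - {c}) {1..i}"
      unfolding surjections_def PiE_def using image_f' by (intro CollectI IntI conjI)
    moreover have "Node U i ts = caterpillar c (\<lambda>j. {v \<in> U - {c}. f' v = j}) i"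
    proof -
      have f_le: "f v \<in> {1..time t0}" if "v \<in> block t0 - {c}" for v
        using f(1) that by (auto simp: surjections_def)
      have "{v \<in> U - {c}. f' v = j} = {v \<in> block t0 - {c}. f v = j}" if "j \<in> {1..time t0}" for j
        using that disj i by (auto simp: U' f'_def)
      then have "caterpillar c (\<lambda>j. {v \<in> U - {c}. f' v = j}) (time t0) =
          caterpillar c (\<lambda>j. {v \<in> block t0 - {c}. f v = j}) (time t0)"
        by (intro caterpillar_cong)
      then have "caterpillar c (\<lambda>j. {v \<in> U - {c}. f' v = j}) (time t0) = t0"
        using f(2) by (rule trans[OF _ sym])
      moreover have "v \<in> U - {c} \<and> f' v = i \<longleftrightarrow> v \<in> B" for v
        unfolding U' f'_def using f_le[of v] i by auto
      then have "{v \<in> U - {c}. f' v = i} = B" by blast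
      moreover have "U = insert c (\<Union>j\<in>{1..i}. {v \<in> U - {c}. f' v = j})"
        using image_f' U(3) by auto
      ultimately show ?thesis using B(1) by (simp add: i ts)
    qed
    ultimately show ?thesis unfolding ltree.sel by (intro bexI[of _ f'])
  qed
qed

lemma hub_tree_caterpillar:
  assumes "\<And>i. i \<in> {1..k} \<Longrightarrow> finite (B i) \<and> B i \<noteq> {}"
  shows "hub_tree c (caterpillar c B k)"
  using assms
proof (induction k)
  case 0
  then show ?case by (simp add: hub_tree_Node)
next
  case (Suc k)
  have fin: "finite (B (Suc k))" "B (Suc k) \<noteq> {}" using Suc.prems by auto
  then have "1 \<le> card (B (Suc k))" by (simp add: Suc_le_eq card_gt_0_iff)
  moreover have "hub_tree c (caterpillar c B k)" using Suc by simp
  moreover have "insert c (\<Union>i\<in>{1..Suc k}. B i) = block (caterpillar c B k) \<union> B (Suc k)"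
    unfolding block_caterpillar UN_atLeastAtMost_Suc by blast
  ultimately show ?case
    using fin unfolding caterpillar.simps hub_tree_Node by (auto simp: hub_tree_Node)
qed

text \<open>
  Adjacency is symmetric, so the time condition on adjacent nodes would also compare a parent with
  a child that has the same block; strictness rules this case out.
\<close>

lemma child_block_psubset_caterpillar:
  assumes "disjoint_family_on B {1..k}"
    and "\<And>i. i \<in> {1..k} \<Longrightarrow> finite (B i) \<and> B i \<noteq> {} \<and> c \<notin> B i"
    and "t \<in> internal_nodes (caterpillar c B k)" "s \<in># children t"
  shows "block s \<subset> block t"
  using assms
proof (induction k)
  case 0
  then show ?case by (simp add: internal_nodes_Node)
next
  case (Suc k)
  have B: "finite (B (Suc k))" "B (Suc k) \<noteq> {}" "c \<notin> B (Suc k)" using Suc.prems(2) by auto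
  have disj: "disjoint_family_on B {1..k}" "B (Suc k) \<inter> (\<Union>i\<in>{1..k}. B i) = {}"
    using Suc.prems(1) unfolding disjoint_family_on_Suc by blast+
  consider "t \<in> internal_nodes (caterpillar c B k)" | "t = caterpillar c B (Suc k)"
    using Suc.prems(3) B by (auto simp: internal_nodes_Node)
  then show ?case
  proof cases
    case 1
    then show ?thesis using Suc.IH[OF disj(1)] Suc.prems(2-4) by simp
  next
    case 2
    obtain v where "v \<in> B (Suc k)" "v \<noteq> c" "v \<notin> (\<Union>i\<in>{1..k}. B i)"
      using B disj(2) by blast
    then have "v \<in> block t" "v \<notin> block (caterpillar c B k)"
      unfolding 2 block_caterpillar UN_atLeastAtMost_Suc by blast+
    moreover have "block (caterpillar c B k) \<subseteq> block t"
      unfolding 2 block_caterpillar UN_atLeastAtMost_Suc by blast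
    ultimately have "block (caterpillar c B k) \<subset> block t" by blast
    moreover have "{v} \<subset> block t" if "v \<in> B (Suc k)" for v
      using B that unfolding 2 block_caterpillar UN_atLeastAtMost_Suc by blast
    moreover have "s = caterpillar c B k \<or> (\<exists>v\<in>B (Suc k). s = leaf v)"
      using Suc.prems(4) B unfolding 2 by auto
    ultimately show ?thesis by (elim disjE bexE) simp_all
  qed
qed

lemma leaf_labels_caterpillar:
  assumes "disjoint_family_on B {1..k}"
    and "\<And>i. i \<in> {1..k} \<Longrightarrow> finite (B i) \<and> c \<notin> B i"
  shows "leaf_labels (caterpillar c B k) =
    image_mset leaf_label (mset_set (insert c (\<Union>i\<in>{1..k}. B i)))"
  using assms
proof (induction k)
  case 0
  then show ?case by simp
next
  case (Suc k)
  have disj: "disjoint_family_on B {1..k}" "B (Suc k) \<inter> (\<Union>i\<in>{1..k}. B i) = {}"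
    using Suc.prems(1) unfolding disjoint_family_on_Suc by blast+
  then have IH: "leaf_labels (caterpillar c B k) =
    image_mset leaf_label (mset_set (insert c (\<Union>i\<in>{1..k}. B i)))"
    using Suc.IH Suc.prems(2) by simp
  have "insert c (\<Union>i\<in>{1..k}. B i) \<inter> B (Suc k) = {}" using disj(2) Suc.prems(2) by auto
  moreover have "insert c (\<Union>i\<in>{1..Suc k}. B i) = insert c (\<Union>i\<in>{1..k}. B i) \<union> B (Suc k)"
    unfolding UN_atLeastAtMost_Suc by blast
  ultimately have "mset_set (insert c (\<Union>i\<in>{1..Suc k}. B i)) =
      mset_set (insert c (\<Union>i\<in>{1..k}. B i)) + mset_set (B (Suc k))"
    using Suc.prems(2) by (simp add: mset_set_Union)
  then show ?case
    unfolding caterpillar.simps leaf_labels.simps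
    by (simp add: IH multiset.map_comp comp_def)
qed

lemma caterpillar_in_nodes: "j \<le> k \<Longrightarrow> caterpillar c B j \<in> nodes (caterpillar c B k)"
  by (induction k) (auto simp: le_Suc_eq)

section \<open>Assembly trees of a star\<close>

text \<open>
  The connected gluing rule enters here: internal blocks have at least two vertices, so
  connectedness puts the centre into each of them.
\<close>

lemma assembly_tree_is_hub_tree:
  assumes "c \<notin> L"
    and "time_dependent_assembly_tree (star_graph c L) T" "connected_gluing_rule (star_graph c L) T"
  shows "hub_tree c T"
  unfolding hub_tree_def
proof (intro ballI conjI)
  note T = assms(2)[unfolded time_dependent_assembly_tree_def]
  fix t assume t: "t \<in> internal_nodes T"
  then have t': "t \<in> nodes T" by (simp add: internal_nodes_def)
  show size: "2 \<le> size (children t)" and union: "block t = \<Union> (block ` set_mset (children t))"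
    using T t by blast+
  have "\<not> is_singleton (block t)"
    using T t' size by (intro internal_block_not_singleton[of T "pverts (star_graph c L)"]) auto
  moreover have "block t \<subseteq> insert c L" using T t' by (auto simp: star_graph_def)
  ultimately show "c \<in> block t"
    using assms(3) t connected_star_iff[OF assms(1), of "block t"]
    unfolding connected_gluing_rule_def by blast
  fix s assume s: "s \<in># children t"
  then have "s \<in> nodes t" by (cases t) (auto intro: bexI[of _ s])
  then have "adjacent_nodes T s t" using s t' nodes_mono by (auto simp: adjacent_nodes_def)
  moreover have "block s \<subseteq> block t" using s by (subst union) auto
  ultimately show "time s < time t" using T by blast
qed

lemma caterpillar_is_assembly_tree:
  assumes "finite L" "c \<notin> L" "f \<in> surjections L {1..k}" "1 \<le> k"
  defines "T \<equiv> caterpillar c (\<lambda>i. {v \<in> L. f v = i}) k"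
  shows "time_dependent_assembly_tree (star_graph c L) T" "connected_gluing_rule (star_graph c L) T"
proof -
  let ?B = "\<lambda>i. {v \<in> L. f v = i}"
  have f: "f ` L = {1..k}" using assms(3) by (simp add: surjections_def)
  have ne: "?B i \<noteq> {}" if "i \<in> {1..k}" for i
    using that unfolding f[symmetric] by auto
  have disj: "disjoint_family_on ?B {1..k}" by (auto simp: disjoint_family_on_def)
  have L: "(\<Union>i\<in>{1..k}. ?B i) = L" using f by auto
  have block: "block T = insert c L" by (simp only: T_def block_caterpillar L)
  have hub: "hub_tree c T" unfolding T_def using assms(1) ne by (intro hub_tree_caterpillar) auto
  have labels: "leaf_labels T = image_mset leaf_label (mset_set (insert c L))"
    unfolding T_def using assms(1,2) disj by (subst leaf_labels_caterpillar) (auto simp only: L, auto)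
  have strict: "block s \<subset> block t" if "t \<in> nodes T" "s \<in># children t" for s t
  proof (rule child_block_psubset_caterpillar[OF disj])
    show "t \<in> internal_nodes (caterpillar c ?B k)"
      using that by (auto simp: internal_nodes_def T_def)
  qed (use assms(1,2) ne that in auto)
  have sub: "block t \<subseteq> insert c L" if "t \<in> nodes T" for t
    using block_mono[OF hub_tree_block[OF hub] that] block by simp
  (* A spine longer than the number of outer vertices would need an empty level. *)
  have "k \<le> card L" using card_image_le[OF assms(1), of f] f by simp
  (* If s is the parent of t, strictness contradicts the inclusion of the blocks. *)
  moreover have "time s < time t" if "adjacent_nodes T s t" "block s \<subseteq> block t" for s t
    using that strict[of t s] strict[of s t] hub by (auto simp: adjacent_nodes_def hub_tree_def internal_nodes_def)
  moreover have "\<exists>t\<in>nodes T. time t = i" if "i \<le> k" for i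
    unfolding T_def by (rule bexI[OF _ caterpillar_in_nodes[OF that]]) simp
  moreover have "time T = k" by (simp add: T_def)
  ultimately show "time_dependent_assembly_tree (star_graph c L) T"
    using hub block labels sub assms(1,2,4)
    unfolding time_dependent_assembly_tree_def hub_tree_def star_graph_def by simp
  show "connected_gluing_rule (star_graph c L) T"
    unfolding connected_gluing_rule_def
  proof
    fix t assume t: "t \<in> internal_nodes T"
    then have t': "t \<in> nodes T" by (simp add: internal_nodes_def)
    have "2 \<le> size (children t)" "c \<in> block t" using hub t unfolding hub_tree_def by blast+
    have "\<not> is_singleton (block t)"
      using hub_tree_block[OF hub] t' \<open>2 \<le> size (children t)\<close> labels
      by (intro internal_block_not_singleton[of T "insert c L"]) auto
    then show "Digraph_Component.connected (with_proj (star_graph c L) \<restriction> block t)"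
      using \<open>c \<in> block t\<close> connected_star_iff[OF assms(2) sub[OF t']] by blast
  qed
qed

lemma assembly_trees_star_eq:
  assumes "finite L" "c \<notin> L"
  shows "{T. time_dependent_assembly_tree (star_graph c L) T \<and> connected_gluing_rule (star_graph c L) T} =
    (\<Union>k\<in>{1..card L}. (\<lambda>f. caterpillar c (\<lambda>i. {v \<in> L. f v = i}) k) ` surjections L {1..k})"
    (is "?A = ?C")
proof
  show "?A \<subseteq> ?C"
  proof
    fix T assume "T \<in> ?A"
    then have T: "time_dependent_assembly_tree (star_graph c L) T"
      and "connected_gluing_rule (star_graph c L) T" by auto
    then have hub: "hub_tree c T" using assembly_tree_is_hub_tree[OF assms(2) T] by simp
    have block: "block T = insert c L" and time: "time T \<in> {1..card L}"
      and labels: "leaf_labels T = image_mset leaf_label (mset_set (insert c L))"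
      and times: "{0..time T} \<subseteq> time ` nodes T"
      using T assms by (auto simp: time_dependent_assembly_tree_def star_graph_def)
    have "block T - {c} = L" using block assms(2) by auto
    then show "T \<in> ?C"
      using hub_tree_is_caterpillar[OF hub, of "insert c L"] block labels times assms(1) time
      by fastforce
  qed
  show "?C \<subseteq> ?A"
    using caterpillar_is_assembly_tree[OF assms] by auto
qed

theorem proposition4p2:
  fixes n :: nat and c :: 'a and L :: "'a set"
  assumes "n \<ge> 1"
    and "finite L" and "card L = n" and "c \<notin> L"
  shows "num_connected_time_assembly_trees (star_graph c L) = (\<Sum>k = 1..n. fact k * Stirling n k)"
proof -
  let ?cat = "\<lambda>k f. caterpillar c (\<lambda>i. {v \<in> L. f v = i}) k"
  have inj: "inj_on (?cat k) (surjections L {1..k})" for k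
  proof (rule inj_onI)
    fix f g assume fg: "f \<in> surjections L {1..k}" "g \<in> surjections L {1..k}" "?cat k f = ?cat k g"
    have eq: "{v \<in> L. f v = i} = {v \<in> L. g v = i}" if "i \<in> {1..k}" for i
      using fg(3) assms(2,4) that
      by (intro caterpillar_inject[where B = "\<lambda>i. {v \<in> L. f v = i}" and k = k])
        (auto simp: disjoint_family_on_def)
    have "f v = g v" if "v \<in> L" for v
    proof -
      have "f v \<in> {1..k}" using fg(1) that by (auto simp: surjections_def)
      then have "v \<in> {v' \<in> L. g v' = f v}" using that by (subst eq[symmetric]) auto
      then show ?thesis by simp
    qed
    then show "f = g"
      using fg(1,2) by (intro PiE_ext[of f L "\<lambda>_. {1..k}" g]) (auto simp: surjections_def)
  qed
  have "num_connected_time_assembly_trees (star_graph c L) =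
      card (\<Union>k\<in>{1..n}. ?cat k ` surjections L {1..k})"
    by (simp add: num_connected_time_assembly_trees_def assembly_trees_star_eq assms)
  (* The time of the root separates the images for different k. *)
  also have "\<dots> = (\<Sum>k = 1..n. card (?cat k ` surjections L {1..k}))"
    using assms(2) by (intro card_UN_disjoint) (auto simp: finite_surjections dest!: arg_cong[where f = time])
  also have "\<dots> = (\<Sum>k = 1..n. fact k * Stirling n k)"
    using assms(2,3) by (intro sum.cong refl) (subst card_image[OF inj], simp add: card_surjections)
  finally show ?thesis .
qed

end
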